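(* Let $A_c\in\mathbb{R}^{n\times n}$, $G\in\mathbb{R}^{m\times n}$, $b\in\mathbb{R}^m$, and let $\mathcal{P}=\{x\in\mathbb{R}^n\mid Gx\le b\}$ be an invariant set for the continuous system $\dot x(t)=A_cx(t)$. Let $H\in\mathbb{R}^{m\times m}$ satisfy $H\ge_o 0$, $HG=GA_c$ and $Hb\le 0$, and let $\gamma>0$ be such that $H+\gamma I\ge 0$. Let $r(t)=g(t)/h(t)$ be a rational function with $r(0)=1$, where $g,h$ are real polynomials, and let $\rho>0$ be the radius of absolute monotonicity of $r$. Put $\tau=\rho/\gamma$, and assume $h(A_c\Delta t)$ is nonsingular for every $\Delta t\in[0,\tau]$. Then $\tau$ is a valid steplength threshold for invariance preserving on $\mathcal{P}$ of the rational function type discretization method $$x_{k+1}=r(A_c\Delta t)x_k .$$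
   Context: Matrix and vector inequalities are entrywise: $M\ge 0$ means all entries of $M$ are nonnegative; $M\ge_o 0$ means all off-diagonal entries of $M$ are nonnegative. A set $\mathcal{S}\subseteq\mathbb{R}^n$ is an invariant set for $\dot x(t)=A_cx(t)$ if $x(0)\in\mathcal{S}$ implies $x(t)\in\mathcal{S}$ for all $t\ge 0$; it is an invariant set for $x_{k+1}=A_dx_k$ if $x_k\in\mathcal{S}$ implies $x_{k+1}\in\mathcal{S}$ for all $k\in\mathbb{N}$ (equivalently $A_d\mathcal{S}\subseteq\mathcal{S}$). Let $\mathcal{P}$ be an invariant set for the continuous system and let a discretization method with steplength $\Delta t$ be applied to it, giving a discrete system. A number $\tau>0$ is a (valid) steplength threshold for invariance preserving of the method on $\mathcal{P}$ if $\mathcal{P}$ is an invariant set for the discrete system for every $\Delta t\in[0,\tau]$ (for every $\Delta t\ge 0$ if $\tau=\infty$). For a rational function $r=g/h$ and a square matrix $M$ with $h(M)$ nonsingular, $r(M):=(h(M))^{-1}g(M)=g(M)(h(M))^{-1}$. The radius of absolute monotonicity of $r:\mathbb{R}\to\mathbb{R}$ is $\rho=\max\{\kappa\ge 0\mid r^{(i)}(t)\ge 0\text{ for all } i=0,1,2,\dots\text{ and all } t\in[-\kappa,0]\}$, where $r^{(i)}$ is the $i$-th derivative and $r^{(0)}=r$ (with $\rho=\infty$ if all $\kappa\ge0$ are admissible). Known fact used to define the data: $\mathcal{P}=\{x\mid Gx\le b\}$ is an invariant set for the continuous system if and only if there is $H\in\mathbb{R}^{m\times m}$ with $H\ge_o0$,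 $HG=GA_c$, $Hb\le 0$; and for such $H$ there always exists $\gamma>0$ with $H+\gamma I\ge 0$. *)

theory Defs
  imports "HOL-Analysis.Analysis" "HOL-Computational_Algebra.Polynomial"
begin

definition offdiag_nonneg :: "real^'m^'m \<Rightarrow> bool" where
  "offdiag_nonneg M \<longleftrightarrow> (\<forall>i j. i \<noteq> j \<longrightarrow> 0 \<le> M $ i $ j)"

definition polyhedron_of :: "real^'n^'m \<Rightarrow> real^'m \<Rightarrow> (real^'n) set" where
  "polyhedron_of G b = {x. G *v x \<le> b}"

definition invariant_continuous :: "real^'n^'n \<Rightarrow> (real^'n) set \<Rightarrow> bool" where
  "invariant_continuous A S \<longleftrightarrow>
     (\<forall>x :: real \<Rightarrow> real^'n.
        (\<forall>t\<ge>0. (x has_vector_derivative A *v x t) (at t within {0..})) \<longrightarrow>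
        x 0 \<in> S \<longrightarrow> (\<forall>t\<ge>0. x t \<in> S))"

definition invariant_discrete :: "real^'n^'n \<Rightarrow> (real^'n) set \<Rightarrow> bool" where
  "invariant_discrete A S \<longleftrightarrow>
     (\<forall>x :: nat \<Rightarrow> real^'n.
        (\<forall>k. x (Suc k) = A *v x k) \<longrightarrow> (\<forall>k. x k \<in> S \<longrightarrow> x (Suc k) \<in> S))"

text \<open>
  A one-step method for a linear system is given by its matrix \<open>\<Phi> d\<close> for steplength \<open>d\<close>.
  The threshold is an extended real, so that \<open>\<tau> = \<infinity>\<close> means every \<open>d \<ge> 0\<close>.
\<close>

definition steplength_threshold ::
  "(real \<Rightarrow> real^'n^'n) \<Rightarrow> (real^'n) set \<Rightarrow> ereal \<Rightarrow> bool" where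
  "steplength_threshold \<Phi> S \<tau> \<longleftrightarrow>
     \<tau> > 0 \<and> (\<forall>d\<ge>0. ereal d \<le> \<tau> \<longrightarrow> invariant_discrete (\<Phi> d) S)"

text \<open>
  Multiplication and \<open>1\<close> on the type \<open>real^'n^'n\<close> are entrywise, so \<open>^\<close> is not the matrix power.
\<close>

primrec matrix_power :: "real^'n^'n \<Rightarrow> nat \<Rightarrow> real^'n^'n" where
  "matrix_power M 0 = mat 1"
| "matrix_power M (Suc k) = M ** matrix_power M k"

definition matrix_poly :: "real poly \<Rightarrow> real^'n^'n \<Rightarrow> real^'n^'n" where
  "matrix_poly p M = (\<Sum>i\<le>degree p. coeff p i *\<^sub>R matrix_power M i)"

text \<open>\<open>g(M) / h(M)\<close>; meaningful only when \<open>matrix_poly h M\<close> is invertible.\<close>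

definition matrix_ratfun :: "real poly \<Rightarrow> real poly \<Rightarrow> real^'n^'n \<Rightarrow> real^'n^'n" where
  "matrix_ratfun g h M = matrix_inv (matrix_poly h M) ** matrix_poly g M"

text \<open>
  \<open>deriv\<close> is total, so existence of all the derivatives is required explicitly;
  in particular no pole of \<open>r\<close> can lie in \<open>S\<close>.
\<close>

definition absolutely_monotonic_on :: "(real \<Rightarrow> real) \<Rightarrow> real set \<Rightarrow> bool" where
  "absolutely_monotonic_on r S \<longleftrightarrow>
     (\<forall>i. \<forall>t\<in>S. (deriv ^^ i) r field_differentiable (at t) \<and> 0 \<le> (deriv ^^ i) r t)"

text \<open>
  A relation rather than a function, since the maximum need not exist for an arbitrary \<open>r\<close>.
\<close>

definition abs_monotonicity_radius :: "(real \<Rightarrow> real) \<Rightarrow> ereal \<Rightarrow> bool" where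
  "abs_monotonicity_radius r \<rho> \<longleftrightarrow>
     (\<rho> = \<infinity> \<and> (\<forall>\<kappa>\<ge>0. absolutely_monotonic_on r {-\<kappa>..0})) \<or>
     (\<exists>\<kappa>\<ge>0. \<rho> = ereal \<kappa> \<and> absolutely_monotonic_on r {-\<kappa>..0} \<and>
        (\<forall>\<kappa>'\<ge>0. absolutely_monotonic_on r {-\<kappa>'..0} \<longrightarrow> \<kappa>' \<le> \<kappa>))"

text \<open>
  \<open>r = g / h\<close> as a function.  Its values at zeros of \<open>h\<close> are left open: a removable singularity
  may thus be filled in by the continuous extension, and \<open>g\<close>, \<open>h\<close> need not be coprime.
\<close>

definition is_ratfun :: "(real \<Rightarrow> real) \<Rightarrow> real poly \<Rightarrow> real poly \<Rightarrow> bool" where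
  "is_ratfun r g h \<longleftrightarrow> h \<noteq> 0 \<and> (\<forall>t. poly h t \<noteq> 0 \<longrightarrow> r t = poly g t / poly h t)"

end

theory Submission
  imports Defs
begin

text \<open>
  Put \<open>E = H + \<gamma> I\<close>, \<open>B = A + \<gamma> I\<close> and \<open>\<kappa> = d \<gamma>\<close>.  Then \<open>E \<ge> 0\<close>, \<open>E G = G B\<close> and
  \<open>E b \<le> \<gamma> b\<close>, so \<open>G x \<le> b\<close> implies \<open>G B\<^sup>k x \<le> \<gamma>\<^sup>k b\<close> for all \<open>k\<close>.  Absolute monotonicity
  makes the coefficients \<open>c\<^sub>k\<close> of the expansion \<open>r z = (\<Sum>k. c\<^sub>k (z + \<kappa>)\<^sup>k)\<close> nonnegative, and
  formally \<open>G r(d A) x = (\<Sum>k. c\<^sub>k d\<^sup>k G B\<^sup>k x) \<le> (\<Sum>k. c\<^sub>k \<kappa>\<^sup>k) b = r 0 b = b\<close>.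

  The difficulty is convergence: nothing bounds the spectral radius of \<open>d E\<close> by the radius of
  convergence of the series.  Two facts in the spirit of Pringsheim's theorem (a power series with
  nonnegative coefficients has a singularity at the positive point of its circle of convergence)
  show that only real singularities matter.

  \<^item> For the scalar series: the nonnegative derivatives at \<open>-\<kappa>\<close> propagate along the real axis up to
    the first pole of \<open>r\<close>, and Taylor's formula then bounds the partial sums at \<open>\<beta>\<close> by \<open>r \<beta>\<close>; so the
    series converges at every \<open>\<beta> \<ge> 0\<close> such that \<open>h\<close> has no zero in \<open>{0..\<beta>}\<close>
    (\<open>absolutely_monotonic_ratfun_fps\<close>).

  \<^item> For the orbit: if \<open>A\<close> has no real eigenvalue in \<open>{\<nu>..}\<close>, where \<open>\<nu> > 0\<close>, then \<open>l (l I - A)\<^sup>-\<^sup>1\<close> maps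
    the polyhedron into itself for all \<open>l \<ge> \<nu>\<close>; this is clear for large \<open>l\<close> and is carried downwards
    in steps of fixed length (\<open>polyhedron_of_resolvent\<close>).  It follows that
    \<open>G B\<^sup>k x\<close> grows at most like \<open>(\<nu> + \<gamma>)\<^sup>k\<close> (\<open>polyhedron_orbit_growth\<close>).

  Both apply with \<open>\<beta> = d \<nu>\<close> for a suitable \<open>\<nu>\<close> (\<open>exists_eigenvalue_bound\<close>): if \<open>p\<close> is the least positive
  zero of \<open>h\<close>, an eigenvalue \<open>l \<ge> p / d\<close> of \<open>A\<close> would make \<open>h((p / l) A)\<close> singular although
  \<open>p / l \<le> d\<close>.  The series \<open>\<Sum>k. c\<^sub>k d\<^sup>k G B\<^sup>k x\<close> then converges absolutely, since \<open>d (\<nu> + \<gamma>) = \<kappa> + \<beta>\<close>.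
  Its sum is \<open>G r(d A) x\<close>, because the formal identity \<open>h \<cdot> (\<Sum>k. c\<^sub>k (z + \<kappa>)\<^sup>k) = g\<close> determines it modulo
  the kernel of \<open>G\<close>, on which \<open>h(d A)\<close> is bijective.
\<close>

section \<open>Rational functions with nonnegative Taylor coefficients\<close>

lemma has_fps_expansion_poly_shift:
  fixes p :: "real poly"
  shows "(\<lambda>z. poly p (t + z)) has_fps_expansion fps_of_poly (pcompose p [:t, 1:])"
proof -
  have "poly q has_fps_expansion fps_of_poly q" for q :: "real poly"
  proof (induction q)
    case (pCons a q)
    have "(\<lambda>z. a + z * poly q z) has_fps_expansion fps_const a + fps_X * fps_of_poly q"
      by (intro fps_expansion_intros pCons.IH)
    then show ?case
      by (simp add: fps_of_poly_pCons poly_pCons[abs_def] mult.commute)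
  qed (simp add: poly_0[abs_def])
  moreover have "(\<lambda>z. poly p (t + z)) = poly (pcompose p [:t, 1:])"
    by (simp add: fun_eq_iff poly_pcompose)
  ultimately show ?thesis
    by (simp only:)
qed

lemma coeff_0_pcompose_shift:
  "coeff (pcompose p [:t, 1:]) 0 = poly p t"
  by (simp add: poly_0_coeff_0[symmetric] poly_pcompose)

lemma has_fps_expansion_ratfun:
  fixes g h :: "real poly"
  assumes "poly h t \<noteq> 0"
  shows "(\<lambda>z. poly g (t + z) / poly h (t + z)) has_fps_expansion
    fps_of_poly (pcompose g [:t, 1:]) / fps_of_poly (pcompose h [:t, 1:])"
  by (intro has_fps_expansion_divide' has_fps_expansion_poly_shift)
     (simp add: coeff_0_pcompose_shift assms)

lemma has_fps_expansion_higher_deriv: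
  fixes f :: "real \<Rightarrow> real"
  assumes "f has_fps_expansion F"
  shows "(deriv ^^ i) f has_fps_expansion (fps_deriv ^^ i) F"
  by (induction i) (auto simp: assms intro: has_fps_expansion_deriv)

lemma fps_nth_higher_fps_deriv:
  "fps_nth ((fps_deriv ^^ i) F) k = pochhammer (of_nat (Suc k)) i * fps_nth F (k + i)"
  for F :: "real fps"
proof (induction i arbitrary: k)
  case (Suc i)
  have "fps_nth ((fps_deriv ^^ Suc i) F) k
      = of_nat (Suc k) * (pochhammer (of_nat (Suc (Suc k))) i * fps_nth F (Suc k + i))"
    by (simp add: Suc.IH[of "Suc k"] del: of_nat_Suc)
  also have "\<dots> = pochhammer (of_nat (Suc k)) (Suc i) * fps_nth F (k + Suc i)"
    by (simp only: pochhammer_rec of_nat_Suc add.commute[of _ 1] mult.assoc add_Suc_right add_Suc)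
  finally show ?case .
qed simp

lemma real_fps_nth_fps_expansion:
  fixes f :: "real \<Rightarrow> real"
  assumes "f has_fps_expansion F"
  shows "fps_nth F i = (deriv ^^ i) f 0 / fact i"
proof -
  have "(deriv ^^ i) f 0 = eval_fps ((fps_deriv ^^ i) F) 0"
    using has_fps_expansion_higher_deriv[OF assms, of i]
    by (auto simp: has_fps_expansion_def dest!: eventually_nhds_x_imp_x)
  also have "\<dots> = fact i * fps_nth F i"
    by (simp add: eval_fps_at_0 fps_nth_higher_fps_deriv pochhammer_fact)
  finally show ?thesis by simp
qed

text \<open>
  The interval \<open>[0, e)\<close> serves all orders of differentiation at once.
\<close>

lemma fps_expansion_nonneg_imp_derivs_nonneg:
  fixes f :: "real \<Rightarrow> real"
  assumes f: "f has_fps_expansion F" and nn: "\<And>k. 0 \<le> fps_nth F k"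
  obtains e where "e > 0" "\<And>i z. 0 \<le> z \<Longrightarrow> z < e \<Longrightarrow> 0 \<le> (deriv ^^ i) f z"
proof -
  from f obtain e1 where e1: "e1 > 0" "\<And>z. dist z 0 < e1 \<Longrightarrow> eval_fps F z = f z"
    by (auto simp: has_fps_expansion_def eventually_nhds_metric)
  have "fps_conv_radius F > 0" using f by (simp add: has_fps_expansion_def)
  then obtain e2 :: real where e2: "e2 > 0" "ereal e2 < fps_conv_radius F"
    using ereal_dense2[of 0 "fps_conv_radius F"] by auto
  define e where "e = min e1 e2"
  have rad: "fps_conv_radius ((fps_deriv ^^ i) F) \<ge> fps_conv_radius F" for i
    by (induction i) (auto intro: order_trans fps_conv_radius_deriv)
  have main: "(deriv ^^ i) f z = eval_fps ((fps_deriv ^^ i) F) z" if "\<bar>z\<bar> < e" for i z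
    using that
  proof (induction i arbitrary: z)
    case 0
    then show ?case using e1 by (simp add: e_def)
  next
    case (Suc i)
    have "eventually (\<lambda>y. y \<in> {-e<..<e}) (nhds z)"
      using Suc.prems by (intro eventually_nhds_in_open) auto
    then have "eventually (\<lambda>y. (deriv ^^ i) f y = eval_fps ((fps_deriv ^^ i) F) y) (nhds z)"
      by eventually_elim (auto intro!: Suc.IH)
    then have "deriv ((deriv ^^ i) f) z = deriv (eval_fps ((fps_deriv ^^ i) F)) z"
      by (rule deriv_cong_ev) simp
    also have "\<dots> = eval_fps (fps_deriv ((fps_deriv ^^ i) F)) z"
    proof (rule eval_fps_deriv[symmetric])
      have "ereal (norm z) < ereal e2" using Suc.prems by (simp add: e_def)
      then show "ereal (norm z) < fps_conv_radius ((fps_deriv ^^ i) F)"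
        using e2 rad[of i] by (meson less_le_trans less_trans)
    qed
    finally show ?case by simp
  qed
  show thesis
  proof
    show "e > 0" using e1 e2 by (simp add: e_def)
    show "0 \<le> (deriv ^^ i) f z" if "0 \<le> z" "z < e" for i z
    proof -
      have "ereal (norm z) < ereal e2" using that by (simp add: e_def)
      then have "ereal (norm z) < fps_conv_radius ((fps_deriv ^^ i) F)"
        using e2 rad[of i] by (meson less_le_trans less_trans)
      then have "summable (\<lambda>k. fps_nth ((fps_deriv ^^ i) F) k * z ^ k)"
        by (rule summable_fps)
      then have "0 \<le> eval_fps ((fps_deriv ^^ i) F) z"
        unfolding eval_fps_def using that nn
        by (intro suminf_nonneg) (auto simp: fps_nth_higher_fps_deriv intro!: mult_nonneg_nonneg pochhammer_nonneg)
      then show ?thesis using main[of z i] that by simp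
    qed
  qed
qed

lemma higher_deriv_ratfun:
  fixes g h :: "real poly"
  defines "f \<equiv> \<lambda>t. poly g t / poly h t"
  assumes "poly h t \<noteq> 0"
  shows "((deriv ^^ i) f has_field_derivative (deriv ^^ Suc i) f t) (at t)"
proof -
  define F where "F = fps_of_poly (pcompose g [:t, 1:]) / fps_of_poly (pcompose h [:t, 1:])"
  have shift: "(deriv ^^ i) (\<lambda>z. f (t + z)) = (\<lambda>z. (deriv ^^ i) f (t + z))" for i
  proof
    fix z
    show "(deriv ^^ i) (\<lambda>z. f (t + z)) z = (deriv ^^ i) f (t + z)"
      unfolding higher_deriv_shift_0[of i _ z] higher_deriv_shift_0[of i f "t + z"]
      by (simp add: o_def add.assoc)
  qed
  have "(\<lambda>z. f (t + z)) has_fps_expansion F"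
    unfolding f_def F_def using assms(2) by (rule has_fps_expansion_ratfun)
  from has_fps_expansion_higher_deriv[OF this, of i]
  have ex: "(\<lambda>z. (deriv ^^ i) f (t + z)) has_fps_expansion (fps_deriv ^^ i) F"
    by (simp add: shift)
  have "(eval_fps ((fps_deriv ^^ i) F) has_field_derivative eval_fps (fps_deriv ((fps_deriv ^^ i) F)) 0) (at 0)"
    using ex by (intro has_field_derivative_eval_fps) (simp add: has_fps_expansion_def zero_ereal_def)
  moreover have "\<forall>\<^sub>F z in nhds 0. eval_fps ((fps_deriv ^^ i) F) z = (deriv ^^ i) f (t + z)"
    using ex by (simp add: has_fps_expansion_def)
  ultimately have "((\<lambda>z. (deriv ^^ i) f (t + z)) has_field_derivative
      eval_fps (fps_deriv ((fps_deriv ^^ i) F)) 0) (at 0)"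
    by (subst (asm) DERIV_cong_ev[OF refl _ refl])
  then have "((deriv ^^ i) f has_field_derivative eval_fps (fps_deriv ((fps_deriv ^^ i) F)) 0) (at t)"
    by (simp add: DERIV_def)
  from this DERIV_imp_deriv[OF this] show ?thesis
    by simp
qed

text \<open>
  Nonnegativity of all derivatives spreads to the right as long as no pole is met.  The set of points
  up to which it holds is closed by continuity; at its supremum the Taylor coefficients are
  nonnegative, so it extends a little further.
\<close>

lemma ratfun_derivs_nonneg:
  fixes g h :: "real poly"
  defines "f \<equiv> \<lambda>t. poly g t / poly h t"
  assumes nz: "\<And>t. a \<le> t \<Longrightarrow> t \<le> b \<Longrightarrow> poly h t \<noteq> 0"
    and a: "\<And>i. 0 \<le> (deriv ^^ i) f a"
    and t: "a \<le> t" "t \<le> b"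
  shows "0 \<le> (deriv ^^ i) f t"
proof -
  define S where "S = {t\<in>{a..b}. \<forall>s\<in>{a..t}. \<forall>i. 0 \<le> (deriv ^^ i) f s}"
  have "a \<in> S" using a t by (auto simp: S_def)
  have bdd: "bdd_above S" by (auto simp: S_def intro!: bdd_aboveI[of _ b])
  define m where "m = Sup S"
  have m: "a \<le> m" "m \<le> b"
  proof -
    show "a \<le> m"
      unfolding m_def using \<open>a \<in> S\<close> bdd by (rule cSup_upper)
    show "m \<le> b"
      unfolding m_def using \<open>a \<in> S\<close> by (intro cSup_least) (auto simp: S_def)
  qed
  have below: "0 \<le> (deriv ^^ i) f s" if "a \<le> s" "s < m" for i s
  proof -
    from that obtain u where "u \<in> S" "s < u"
      using less_cSup_iff[of S s] bdd \<open>a \<in> S\<close> by (auto simp: m_def)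
    then show ?thesis using that by (auto simp: S_def)
  qed
  have at_m: "0 \<le> (deriv ^^ i) f m" for i
  proof (cases "a = m")
    case False
    have "isCont ((deriv ^^ i) f) m"
      using higher_deriv_ratfun[of h m i g] nz[of m] m DERIV_isCont unfolding f_def by blast
    then have "((deriv ^^ i) f \<longlongrightarrow> (deriv ^^ i) f m) (at_left m)"
      by (simp add: isCont_def filterlim_at_split)
    moreover have "\<forall>\<^sub>F s in at_left m. 0 \<le> (deriv ^^ i) f s"
      using False m by (intro eventually_at_leftI[of a]) (auto intro: below)
    ultimately show ?thesis
      by (intro tendsto_lowerbound[of "(deriv ^^ i) f" _ "at_left m"]) auto
  qed (use a in auto)
  have upto_m: "0 \<le> (deriv ^^ i) f s" if "a \<le> s" "s \<le> m" for i s
    using below[OF that(1)] at_m that(2) by (cases "s = m") auto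
  have "m = b"
  proof (rule ccontr)
    assume "m \<noteq> b"
    have ex: "(\<lambda>z. f (m + z)) has_fps_expansion
        fps_of_poly (pcompose g [:m, 1:]) / fps_of_poly (pcompose h [:m, 1:])" (is "_ has_fps_expansion ?F")
      unfolding f_def by (intro has_fps_expansion_ratfun nz m)
    have "0 \<le> fps_nth ?F k" for k
      using at_m[of k] by (simp add: real_fps_nth_fps_expansion[OF ex] higher_deriv_shift_0[of _ f m] o_def)
    then obtain e where e: "e > 0"
        "\<And>i z. 0 \<le> z \<Longrightarrow> z < e \<Longrightarrow> 0 \<le> (deriv ^^ i) (\<lambda>z. f (m + z)) z"
      using fps_expansion_nonneg_imp_derivs_nonneg[OF ex] by metis
    define u where "u = min b (m + e / 2)"
    have "0 \<le> (deriv ^^ i) f s" if "a \<le> s" "s \<le> u" for i s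
    proof (cases "s \<le> m")
      case False
      have "0 \<le> (deriv ^^ i) (\<lambda>z. f (m + z)) (s - m)"
        using False that e(1) by (intro e(2)) (auto simp: u_def)
      then show ?thesis
        by (simp add: higher_deriv_shift_0[of i f s] higher_deriv_shift_0[of i _ "s - m"] o_def add.assoc)
    qed (use that upto_m in auto)
    then have "u \<in> S" using m e(1) by (auto simp: S_def u_def)
    then have "u \<le> m" using bdd by (auto simp: m_def intro: cSup_upper)
    then show False using e(1) m \<open>m \<noteq> b\<close> by (auto simp: u_def min_def split: if_splits)
  qed
  then show ?thesis using upto_m t by auto
qed

text \<open>
  The Taylor series at \<open>a\<close> converges at \<open>b\<close> although complex poles might seem to limit its radius: the
  remainder is nonnegative, so every partial sum is at most \<open>f b\<close>.
\<close>

lemma ratfun_taylor_summable: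
  fixes g h :: "real poly"
  defines "f \<equiv> \<lambda>t. poly g t / poly h t"
  assumes nz: "\<And>t. a \<le> t \<Longrightarrow> t \<le> b \<Longrightarrow> poly h t \<noteq> 0"
    and a: "\<And>i. 0 \<le> (deriv ^^ i) f a" and "a \<le> b"
  shows "summable (\<lambda>i. (deriv ^^ i) f a / fact i * (b - a) ^ i)"
proof (cases "a = b")
  case True
  then show ?thesis
    by (intro summable_finite[of "{0}"]) auto
next
  case False
  with \<open>a \<le> b\<close> have "a < b" by simp
  have nn: "0 \<le> (deriv ^^ i) f t" if "a \<le> t" "t \<le> b" for i t
    using ratfun_derivs_nonneg[of a b h g t i] nz a that unfolding f_def by blast
  have le: "(\<Sum>i<n. (deriv ^^ i) f a / fact i * (b - a) ^ i) \<le> f b" for n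
  proof (cases "n = 0")
    case True
    then show ?thesis using nn[of b 0] \<open>a < b\<close> by simp
  next
    case False
    have "\<exists>t. a < t \<and> t < b \<and> f b = (\<Sum>m<n. (deriv ^^ m) f a / fact m * (b - a) ^ m)
        + (deriv ^^ n) f t / fact n * (b - a) ^ n"
    proof (rule Taylor_up)
      show "\<forall>m t. m < n \<and> a \<le> t \<and> t \<le> b \<longrightarrow>
          ((deriv ^^ m) f has_field_derivative (deriv ^^ Suc m) f t) (at t)"
        using higher_deriv_ratfun nz unfolding f_def by blast
    qed (use False \<open>a < b\<close> in auto)
    then obtain t where "a < t" "t < b" "f b = (\<Sum>m<n. (deriv ^^ m) f a / fact m * (b - a) ^ m)
        + (deriv ^^ n) f t / fact n * (b - a) ^ n"
      by blast
    moreover have "0 \<le> (deriv ^^ n) f t / fact n * (b - a) ^ n"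
      using nn[of t n] \<open>a < t\<close> \<open>t < b\<close> by simp
    ultimately show ?thesis by linarith
  qed
  show ?thesis
    by (rule summableI_nonneg_bounded[OF _ le]) (use a \<open>a < b\<close> in auto)
qed

lemma poly_remove_common_roots:
  fixes g h :: "real poly"
  assumes "h \<noteq> 0"
  obtains q g1 h1 where "g = q * g1" "h = q * h1" "\<And>t. poly h1 t = 0 \<Longrightarrow> poly g1 t \<noteq> 0"
  using assms
proof (induction "degree h" arbitrary: g h thesis rule: less_induct)
  case less
  show ?case
  proof (cases "\<exists>t. poly h t = 0 \<and> poly g t = 0")
    case True
    then obtain t g' h' where eq: "g = [:-t, 1:] * g'" "h = [:-t, 1:] * h'"
      by (auto simp: poly_eq_0_iff_dvd elim!: dvdE)
    with less.prems have "h' \<noteq> 0" by auto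
    then have "degree h' < degree h" by (simp add: eq(2) degree_mult_eq del: mult_pCons_left)
    from less.hyps[OF this _ \<open>h' \<noteq> 0\<close>] obtain q g1 h1
      where q: "g' = q * g1" "h' = q * h1" and cop: "\<And>t. poly h1 t = 0 \<Longrightarrow> poly g1 t \<noteq> 0"
      by metis
    show ?thesis
    proof (rule less.prems(1))
      show "g = ([:-t, 1:] * q) * g1" "h = ([:-t, 1:] * q) * h1"
        by (simp_all only: eq q mult.assoc)
    qed (fact cop)
  next
    case False
    then show ?thesis by (intro less.prems(1)[of 1 g h]) auto
  qed
qed

text \<open>
  The series \<open>F\<close> is the expansion of \<open>r\<close> at \<open>-\<kappa>\<close>, characterized by \<open>h F = g\<close> after the shift of the
  origin.  It converges at \<open>c\<close>, possibly to the right of the interval on which \<open>r\<close> is assumed to be absolutely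
  monotonic.
\<close>

lemma absolutely_monotonic_ratfun_fps:
  fixes g h :: "real poly"
  assumes r: "is_ratfun r g h" and mono: "absolutely_monotonic_on r {-\<kappa>..0}"
    and "0 \<le> \<kappa>" "0 \<le> c" and nz: "\<And>t. 0 \<le> t \<Longrightarrow> t \<le> c \<Longrightarrow> poly h t \<noteq> 0"
  obtains F :: "real fps"
  where "fps_of_poly (pcompose h [:-\<kappa>, 1:]) * F = fps_of_poly (pcompose g [:-\<kappa>, 1:])"
    and "\<And>k. 0 \<le> fps_nth F k" and "summable (\<lambda>k. fps_nth F k * (\<kappa> + c) ^ k)"
proof -
  have "h \<noteq> 0" and r_eq: "\<And>t. poly h t \<noteq> 0 \<Longrightarrow> r t = poly g t / poly h t"
    using r by (auto simp: is_ratfun_def)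
  obtain q g1 h1 where gh: "g = q * g1" "h = q * h1" and
    cop: "\<And>t. poly h1 t = 0 \<Longrightarrow> poly g1 t \<noteq> 0"
    using poly_remove_common_roots[OF \<open>h \<noteq> 0\<close>] by metis
  define f where "f = (\<lambda>t. poly g1 t / poly h1 t)"
  have "\<forall>\<^sub>F s in at t. poly h s \<noteq> 0" for t
  proof -
    have "open (- ({s. poly h s = 0} - {t}))"
      using poly_roots_finite[OF \<open>h \<noteq> 0\<close>] by (intro open_Compl finite_imp_closed) auto
    then have "\<forall>\<^sub>F s in nhds t. s \<in> - ({s. poly h s = 0} - {t})"
      by (intro eventually_nhds_in_open) auto
    then show ?thesis
      unfolding eventually_at_filter by eventually_elim auto
  qed
  then have ev: "\<forall>\<^sub>F s in at t. poly h1 s \<noteq> 0 \<and> r s = f s" for t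
    by (rule eventually_mono) (auto simp: r_eq f_def gh)
  have cont: "isCont r t" if "t \<in> {-\<kappa>..0}" for t
  proof -
    have "(deriv ^^ 0) r field_differentiable at t"
      using mono that unfolding absolutely_monotonic_on_def by blast
    then show ?thesis
      by (simp add: field_differentiable_imp_continuous_at)
  qed
  \<comment> \<open>On \<open>{-\<kappa>..0}\<close> the function \<open>r\<close> is continuous, so \<open>h\<close> can vanish only at removable singularities.\<close>
  have nz1: "poly h1 t \<noteq> 0" if "t \<in> {-\<kappa>..c}" for t
  proof (cases "t \<le> 0")
    case True
    show ?thesis
    proof
      assume "poly h1 t = 0"
      have "((\<lambda>s. r s * poly h1 s) \<longlongrightarrow> r t * poly h1 t) (at t)"
        using cont[of t] that True by (intro tendsto_mult) (auto simp: isCont_def[symmetric])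
      moreover have "\<forall>\<^sub>F s in at t. r s * poly h1 s = poly g1 s"
        using ev[of t] by eventually_elim (auto simp: f_def)
      ultimately have "(poly g1 \<longlongrightarrow> r t * poly h1 t) (at t)"
        using Lim_transform_eventually by blast
      moreover have "(poly g1 \<longlongrightarrow> poly g1 t) (at t)"
        by (simp add: isCont_def[symmetric])
      ultimately have "poly g1 t = r t * poly h1 t"
        using LIM_unique by blast
      with \<open>poly h1 t = 0\<close> cop show False by auto
    qed
  next
    case False
    with nz[of t] that show ?thesis by (auto simp: gh)
  qed
  have "isCont f (-\<kappa>)"
    unfolding f_def using nz1[of "-\<kappa>"] \<open>0 \<le> \<kappa>\<close> \<open>0 \<le> c\<close> by (intro continuous_intros) auto
  \<comment> \<open>At \<open>-\<kappa>\<close> itself \<open>h\<close> may vanish; there the two functions agree by continuity.\<close>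
  have rf: "\<forall>\<^sub>F s in nhds (-\<kappa>). r s = f s"
  proof -
    have "\<forall>\<^sub>F s in at (-\<kappa>). r s = f s"
      using ev[of "-\<kappa>"] by (rule eventually_mono) simp
    moreover have "r (-\<kappa>) = f (-\<kappa>)"
    proof (rule LIM_unique)
      have "(r \<longlongrightarrow> r (-\<kappa>)) (at (-\<kappa>))"
        using cont[of "-\<kappa>"] \<open>0 \<le> \<kappa>\<close> by (simp add: isCont_def)
      then show "(f \<longlongrightarrow> r (-\<kappa>)) (at (-\<kappa>))"
        using calculation by (rule Lim_transform_eventually)
      show "(f \<longlongrightarrow> f (-\<kappa>)) (at (-\<kappa>))"
        using \<open>isCont f (-\<kappa>)\<close> by (simp add: isCont_def)
    qed
    ultimately show ?thesis
      by (simp add: eventually_nhds_conv_at)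
  qed
  have nn: "0 \<le> (deriv ^^ i) f (-\<kappa>)" for i
  proof -
    have "0 \<le> (deriv ^^ i) r (-\<kappa>)"
      using mono \<open>0 \<le> \<kappa>\<close> unfolding absolutely_monotonic_on_def by simp
    then show ?thesis
      by (simp add: higher_deriv_cong_ev[OF rf refl])
  qed
  define F where "F = fps_of_poly (pcompose g1 [:-\<kappa>, 1:]) / fps_of_poly (pcompose h1 [:-\<kappa>, 1:])"
  have ex: "(\<lambda>z. f (-\<kappa> + z)) has_fps_expansion F"
    unfolding f_def F_def using nz1[of "-\<kappa>"] \<open>0 \<le> \<kappa>\<close> \<open>0 \<le> c\<close> by (intro has_fps_expansion_ratfun) auto
  have coeff_F: "fps_nth F k = (deriv ^^ k) f (-\<kappa>) / fact k" for k
    by (simp add: real_fps_nth_fps_expansion[OF ex] higher_deriv_shift_0[of _ f "-\<kappa>"] o_def)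
  show thesis
  proof
    have "fps_nth (fps_of_poly (pcompose h1 [:-\<kappa>, 1:])) 0 \<noteq> 0"
      using nz1[of "-\<kappa>"] \<open>0 \<le> \<kappa>\<close> \<open>0 \<le> c\<close> by (simp add: coeff_0_pcompose_shift)
    then have "fps_of_poly (pcompose h1 [:-\<kappa>, 1:]) * F = fps_of_poly (pcompose g1 [:-\<kappa>, 1:])"
      unfolding F_def by (simp add: fps_divide_unit inverse_mult_eq_1' mult.left_commute)
    then show "fps_of_poly (pcompose h [:-\<kappa>, 1:]) * F = fps_of_poly (pcompose g [:-\<kappa>, 1:])"
      by (simp only: gh pcompose_mult fps_of_poly_mult mult.assoc)
    show "0 \<le> fps_nth F k" for k
      using nn by (simp add: coeff_F)
    have "summable (\<lambda>k. (deriv ^^ k) f (-\<kappa>) / fact k * (c - (-\<kappa>)) ^ k)"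
      unfolding f_def using nz1 nn \<open>0 \<le> \<kappa>\<close> \<open>0 \<le> c\<close> unfolding f_def
      by (intro ratfun_taylor_summable) auto
    then show "summable (\<lambda>k. fps_nth F k * (\<kappa> + c) ^ k)"
      by (simp add: coeff_F add.commute)
  qed
qed

section \<open>Polynomials of matrices\<close>

lemma matrix_power_scaleR: "matrix_power (c *\<^sub>R M) k = c ^ k *\<^sub>R matrix_power M k"
  by (induction k) (simp_all add: matrix_scalar_ac scalar_matrix_assoc[symmetric])

lemma matrix_poly_altdef:
  assumes "degree p \<le> n"
  shows "matrix_poly p M = (\<Sum>i\<le>n. coeff p i *\<^sub>R matrix_power M i)"
  unfolding matrix_poly_def using assms
  by (intro sum.mono_neutral_left) (auto intro: coeff_eq_0)

lemma matrix_poly_0: "matrix_poly 0 M = 0"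
  by (simp add: matrix_poly_def)

lemma matrix_poly_add: "matrix_poly (p + q) M = matrix_poly p M + matrix_poly q M"
proof -
  let ?n = "max (degree p) (degree q)"
  show ?thesis
    by (simp add: matrix_poly_altdef[of _ ?n] degree_add_le scaleR_left_distrib sum.distrib)
qed

lemma matrix_poly_smult: "matrix_poly (smult c p) M = c *\<^sub>R matrix_poly p M"
  by (simp add: matrix_poly_altdef[of _ "degree p"] scaleR_sum_right)

lemma matrix_add_rdistrib: "(A + B) ** C = A ** C + B ** C"
  for A B :: "real^'n^'m"
  by (simp add: vec_eq_iff matrix_matrix_mult_def distrib_right sum.distrib)

lemma matrix_mult_sum_right: "M ** (\<Sum>i\<in>I. f i) = (\<Sum>i\<in>I. M ** f i)"
  for M :: "real^'n^'m" and f :: "'i \<Rightarrow> real^'k^'n"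
  by (induction I rule: infinite_finite_induct) (simp_all add: matrix_add_ldistrib)

lemma matrix_vector_mult_sum_left: "(\<Sum>i\<in>I. f i) *v x = (\<Sum>i\<in>I. f i *v x)"
  for f :: "'i \<Rightarrow> real^'n^'m"
  by (induction I rule: infinite_finite_induct) (simp_all add: matrix_vector_mult_add_rdistrib)

lemma matrix_vector_mult_sum_right: "M *v (\<Sum>i\<in>I. f i) = (\<Sum>i\<in>I. M *v f i)"
  for M :: "real^'n^'m"
  by (induction I rule: infinite_finite_induct) (simp_all add: matrix_vector_right_distrib)

lemma matrix_poly_pCons: "matrix_poly (pCons a p) M = a *\<^sub>R mat 1 + M ** matrix_poly p M"
proof -
  have "matrix_poly (pCons a p) M = (\<Sum>i\<le>Suc (degree p). coeff (pCons a p) i *\<^sub>R matrix_power M i)"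
    by (rule matrix_poly_altdef) (rule degree_pCons_le)
  also have "\<dots> = a *\<^sub>R mat 1 + (\<Sum>i\<le>degree p. coeff p i *\<^sub>R (M ** matrix_power M i))"
    unfolding sum.atMost_Suc_shift by simp
  also have "\<dots> = a *\<^sub>R mat 1 + M ** matrix_poly p M"
    by (simp add: matrix_poly_def matrix_mult_sum_right matrix_scalar_ac scalar_matrix_assoc)
  finally show ?thesis .
qed

lemma matrix_poly_pcompose_shift:
  "matrix_poly (pcompose p [:c, 1:]) M = matrix_poly p (c *\<^sub>R mat 1 + M)"
proof (induction p)
  case (pCons a p)
  have "matrix_poly (pcompose (pCons a p) [:c, 1:]) M
      = a *\<^sub>R mat 1 + (c *\<^sub>R matrix_poly (pcompose p [:c, 1:]) M + M ** matrix_poly (pcompose p [:c, 1:]) M)"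
    by (simp add: pcompose_pCons matrix_poly_add matrix_poly_smult matrix_poly_pCons matrix_poly_0)
  also have "\<dots> = matrix_poly (pCons a p) (c *\<^sub>R mat 1 + M)"
    by (simp add: pCons.IH matrix_poly_pCons matrix_add_rdistrib scalar_matrix_assoc[symmetric])
  finally show ?case .
qed (simp add: matrix_poly_0)

lemma matrix_poly_mult_vector:
  "matrix_poly p M *v x = (\<Sum>i\<le>degree p. coeff p i *\<^sub>R (matrix_power M i *v x))"
  by (simp add: matrix_poly_def matrix_vector_mult_sum_left scaleR_matrix_vector_assoc)

lemma matrix_poly_intertwine:
  fixes G :: "real^'n^'m"
  assumes "H ** G = G ** A"
  shows "matrix_poly p H ** G = G ** matrix_poly p A"
proof (induction p)
  case (pCons a p)
  have "H ** matrix_poly p H ** G = H ** G ** matrix_poly p A"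
    by (simp add: matrix_mul_assoc[symmetric] pCons.IH)
  also have "\<dots> = G ** (A ** matrix_poly p A)"
    by (simp add: assms matrix_mul_assoc)
  finally show ?case
    by (simp add: matrix_poly_pCons matrix_add_ldistrib matrix_add_rdistrib
        matrix_scalar_ac scalar_matrix_assoc[symmetric])
qed (simp add: matrix_poly_0 matrix_matrix_mult_def vec_eq_iff)

lemma matrix_poly_eigenvector:
  assumes "M *v x = c *\<^sub>R x"
  shows "matrix_poly p M *v x = poly p c *\<^sub>R x"
  by (induction p)
     (simp_all add: matrix_poly_0 matrix_poly_pCons matrix_vector_mult_add_rdistrib
       scaleR_matrix_vector_assoc[symmetric] matrix_vector_mul_assoc[symmetric]
       matrix_vector_mult_scaleR assms scaleR_add_left mult.commute)

lemma invertible_mult_eq_0: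
  fixes M :: "real^'n^'n"
  assumes "invertible M" "M *v x = 0"
  shows "x = 0"
  using assms matrix_left_invertible_ker[of M] by (auto simp: invertible_left_inverse)

lemma matrix_inv_left_right:
  assumes "invertible M"
  shows "M ** matrix_inv M = mat 1" "matrix_inv M ** M = mat 1"
  using assms someI_ex[of "\<lambda>A'. M ** A' = mat 1 \<and> A' ** M = mat 1"]
  unfolding matrix_inv_def invertible_def by auto

lemma invertible_if_ker_trivial:
  fixes M :: "real^'n^'n"
  assumes "\<And>x. M *v x = 0 \<Longrightarrow> x = 0"
  shows "invertible M"
  using assms matrix_left_invertible_ker[of M] by (auto simp: invertible_left_inverse)

text \<open>
  An invertible \<open>M\<close> that maps the kernel of \<open>G\<close> into itself maps it onto itself, by comparison of
  dimensions.
\<close>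

lemma invertible_stable_kernel:
  fixes M :: "real^'n^'n" and G :: "real^'n^'m"
  assumes "invertible M" and stable: "\<And>v. G *v v = 0 \<Longrightarrow> G *v (M *v v) = 0"
    and "G *v (M *v v) = 0"
  shows "G *v v = 0"
proof -
  let ?K = "{v. G *v v = 0}"
  have K: "subspace ?K"
    by (auto simp: subspace_def algebra_simps)
  have inj: "inj ((*v) M)"
    using assms(1) by (metis invertible_left_inverse matrix_left_invertible_injective)
  have "(*v) M ` ?K = ?K"
  proof (rule subspace_dim_equal)
    show "subspace ((*v) M ` ?K)"
      using K by (intro linear_subspace_image) auto
    show "dim ?K \<le> dim ((*v) M ` ?K)"
      using dim_image_eq[of "(*v) M" ?K] inj by (simp add: inj_on_subset[OF inj])
  qed (use K stable in auto)
  moreover have "M *v v \<in> ?K" using assms(3) by simp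
  ultimately have "M *v v \<in> (*v) M ` ?K" by simp
  then have "v \<in> ?K" using inj by (simp only: inj_image_mem_iff)
  then show ?thesis by simp
qed

section \<open>Resolvents and orbits on a polyhedron\<close>

lemma polyhedron_of_add:
  assumes "u \<in> polyhedron_of G b" "v \<in> polyhedron_of G c"
  shows "u + v \<in> polyhedron_of G (b + c)"
  using assms by (simp add: polyhedron_of_def matrix_vector_right_distrib add_mono)

lemma polyhedron_of_scaleR:
  assumes "0 \<le> c" "u \<in> polyhedron_of G b"
  shows "c *\<^sub>R u \<in> polyhedron_of G (c *\<^sub>R b)"
  using assms
  by (simp add: polyhedron_of_def matrix_vector_mult_scaleR less_eq_vec_def mult_left_mono)

lemma polyhedron_of_limit:
  fixes G :: "real^'n^'m" and y :: "nat \<Rightarrow> real^'n"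
  assumes "\<And>k. y k \<in> polyhedron_of G (s k *\<^sub>R b)" "y \<longlonglongrightarrow> l" "s \<longlonglongrightarrow> t"
  shows "l \<in> polyhedron_of G (t *\<^sub>R b)"
proof -
  have "(G *v l) $ j \<le> (t *\<^sub>R b) $ j" for j
  proof (rule LIMSEQ_le)
    have "(\<lambda>k. G *v y k) \<longlonglongrightarrow> G *v l"
      using assms(2) by (intro bounded_linear.tendsto[OF matrix_vector_mul_bounded_linear])
    then show "(\<lambda>k. (G *v y k) $ j) \<longlonglongrightarrow> (G *v l) $ j"
      by (rule tendsto_vec_nth)
    show "(\<lambda>k. (s k *\<^sub>R b) $ j) \<longlonglongrightarrow> (t *\<^sub>R b) $ j"
      by (intro tendsto_vec_nth tendsto_scaleR assms tendsto_const)
    show "\<exists>N. \<forall>k\<ge>N. (G *v y k) $ j \<le> (s k *\<^sub>R b) $ j"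
      using assms(1) by (simp add: polyhedron_of_def less_eq_vec_def)
  qed
  then show ?thesis by (simp add: polyhedron_of_def less_eq_vec_def)
qed

lemma nonneg_matrix_vector_mono:
  fixes E :: "real^'m^'k"
  assumes "0 \<le> E" "u \<le> v"
  shows "E *v u \<le> E *v v"
  using assms
  by (auto simp: less_eq_vec_def matrix_vector_mult_def intro!: sum_mono mult_left_mono)

lemma polyhedron_of_shift_step:
  fixes G :: "real^'n^'m"
  assumes "0 \<le> E" "E ** G = G ** B" "E *v b \<le> \<gamma> *\<^sub>R b"
    and "0 \<le> s" "x \<in> polyhedron_of G (s *\<^sub>R b)"
  shows "B *v x \<in> polyhedron_of G ((\<gamma> * s) *\<^sub>R b)"
proof -
  have "G *v (B *v x) = E *v (G *v x)"
    by (simp add: matrix_vector_mul_assoc assms(2))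
  also have "\<dots> \<le> E *v (s *\<^sub>R b)"
    using assms(5) by (intro nonneg_matrix_vector_mono assms) (simp add: polyhedron_of_def)
  also have "\<dots> = s *\<^sub>R (E *v b)"
    by (simp add: matrix_vector_mult_scaleR)
  also have "\<dots> \<le> s *\<^sub>R (\<gamma> *\<^sub>R b)"
    using assms(3,4) by (simp add: less_eq_vec_def mult_left_mono mult.assoc)
  finally show ?thesis
    by (simp add: polyhedron_of_def mult.commute)
qed

lemma polyhedron_of_shift_power:
  fixes G :: "real^'n^'m"
  assumes "0 \<le> E" "E ** G = G ** B" "E *v b \<le> \<gamma> *\<^sub>R b" "0 \<le> \<gamma>"
    and "x \<in> polyhedron_of G b"
  shows "matrix_power B k *v x \<in> polyhedron_of G (\<gamma> ^ k *\<^sub>R b)"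
proof (induction k)
  case (Suc k)
  have "B *v (matrix_power B k *v x) \<in> polyhedron_of G ((\<gamma> * \<gamma> ^ k) *\<^sub>R b)"
    using assms Suc by (intro polyhedron_of_shift_step) auto
  then show ?case by (simp add: matrix_vector_mul_assoc)
qed (use assms in simp)

text \<open>
  If \<open>T\<close> is a contraction that scales the bound \<open>b\<close> by \<open>a < 1\<close>, the iterates \<open>z \<mapsto> x + T z\<close> started at \<open>0\<close>
  stay below the partial sums of \<open>s (1 + a + a\<^sup>2 + \<dots>)\<close>, hence so does their limit.
\<close>

lemma polyhedron_of_fixpoint:
  fixes G :: "real^'n^'m" and T :: "real^'n^'n"
  assumes a: "0 \<le> a" "a < 1" and q: "0 \<le> q" "q < 1" "\<And>v. norm (T *v v) \<le> q * norm v"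
    and T: "\<And>s v. 0 \<le> s \<Longrightarrow> v \<in> polyhedron_of G (s *\<^sub>R b) \<Longrightarrow> T *v v \<in> polyhedron_of G ((a * s) *\<^sub>R b)"
    and x: "0 \<le> s" "x \<in> polyhedron_of G (s *\<^sub>R b)"
    and y: "y = x + T *v y"
  shows "y \<in> polyhedron_of G ((s / (1 - a)) *\<^sub>R b)"
proof -
  define z where "z k = ((\<lambda>v. x + T *v v) ^^ k) 0" for k
  have z_Suc: "z (Suc k) = x + T *v z k" for k by (simp add: z_def)
  have z_in: "z k \<in> polyhedron_of G ((s * (\<Sum>i<k. a ^ i)) *\<^sub>R b)" for k
  proof (induction k)
    case 0
    show ?case by (simp add: z_def polyhedron_of_def)
  next
    case (Suc k)
    have "x + T *v z k \<in> polyhedron_of G (s *\<^sub>R b + (a * (s * (\<Sum>i<k. a ^ i))) *\<^sub>R b)"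
      using x a Suc by (intro polyhedron_of_add T) (auto intro!: mult_nonneg_nonneg sum_nonneg)
    also have "s *\<^sub>R b + (a * (s * (\<Sum>i<k. a ^ i))) *\<^sub>R b = (s * (\<Sum>i<Suc k. a ^ i)) *\<^sub>R b"
      unfolding sum.lessThan_Suc_shift by (simp add: sum_distrib_left algebra_simps)
    finally show ?case by (simp only: z_Suc)
  qed
  have dist_z: "norm (z k - y) \<le> q ^ k * norm y" for k
  proof (induction k)
    case (Suc k)
    have "z (Suc k) - y = T *v (z k - y)"
      by (subst y) (simp add: z_Suc matrix_vector_mult_diff_distrib)
    then have "norm (z (Suc k) - y) \<le> q * norm (z k - y)"
      using q(3) by simp
    also have "\<dots> \<le> q * (q ^ k * norm y)"
      using q Suc by (intro mult_left_mono)
    finally show ?case by (simp add: mult.assoc)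
  qed (simp add: z_def)
  show ?thesis
  proof (rule polyhedron_of_limit[OF z_in])
    have "(\<lambda>k. z k - y) \<longlonglongrightarrow> 0"
    proof (rule Lim_null_comparison[OF always_eventually])
      show "\<forall>k. norm (z k - y) \<le> q ^ k * norm y" using dist_z by blast
      show "(\<lambda>k. q ^ k * norm y) \<longlonglongrightarrow> 0"
        using q by (intro tendsto_mult_left_zero LIMSEQ_power_zero) auto
    qed
    then show "z \<longlonglongrightarrow> y" by (simp add: LIM_zero_iff)
    have "(\<lambda>i. a ^ i) sums (1 / (1 - a))"
      using a by (intro geometric_sums) auto
    then show "(\<lambda>k. s * (\<Sum>i<k. a ^ i)) \<longlonglongrightarrow> s / (1 - a)"
      unfolding sums_def by (auto dest: tendsto_mult_left[of _ _ _ s])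
  qed
qed

lemma matrix_norm_bound:
  fixes M :: "real^'n^'m"
  obtains K where "K > 0" "\<And>v. norm (M *v v) \<le> K * norm v"
  using bounded_linear.pos_bounded[OF matrix_vector_mul_bounded_linear[of M]]
  by (auto simp: mult.commute)

lemma uniform_lower_bound:
  fixes A :: "real^'n^'n"
  assumes "\<And>l v. l \<in> {\<alpha>..\<beta>} \<Longrightarrow> A *v v = l *\<^sub>R v \<Longrightarrow> v = 0" "\<alpha> \<le> \<beta>"
  shows "\<exists>e>0. \<forall>l\<in>{\<alpha>..\<beta>}. \<forall>v. e * norm v \<le> norm (l *\<^sub>R v - A *v v)"
proof -
  let ?S = "{\<alpha>..\<beta>} \<times> sphere (0 :: real^'n) 1"
  let ?f = "\<lambda>(l, v). norm (l *\<^sub>R v - A *v v)"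
  have "compact ?S"
    by (intro compact_Times compact_Icc compact_sphere)
  moreover obtain v0 :: "real^'n" where "norm v0 = 1"
    using vector_choose_size[of 1] by auto
  then have "(\<alpha>, v0) \<in> ?S" using assms(2) by simp
  then have "?S \<noteq> {}" by blast
  moreover have "continuous_on ?S ?f"
    unfolding split_def
    by (intro continuous_intros bounded_linear.continuous_on[OF matrix_vector_mul_bounded_linear])
  ultimately obtain m where m: "m \<in> ?S" "\<And>x. x \<in> ?S \<Longrightarrow> ?f m \<le> ?f x"
    by (meson continuous_attains_inf)
  have "?f m > 0"
    using m(1) assms(1)[of "fst m" "snd m"] by (auto simp: split_def)
  moreover have "?f m * norm v \<le> norm (l *\<^sub>R v - A *v v)" if "l \<in> {\<alpha>..\<beta>}" for l v
  proof (cases "v = 0")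
    case False
    let ?u = "(1 / norm v) *\<^sub>R v"
    have "?f m \<le> ?f (l, ?u)"
      using that False by (intro m(2)) auto
    also have "l *\<^sub>R ?u - A *v ?u = (1 / norm v) *\<^sub>R (l *\<^sub>R v - A *v v)"
      by (simp add: matrix_vector_mult_scaleR scaleR_diff_right)
    then have "?f (l, ?u) = norm (l *\<^sub>R v - A *v v) / norm v"
      by simp
    finally show ?thesis
      using False by (simp add: field_simps)
  qed simp
  ultimately show ?thesis by blast
qed

text \<open>
  With \<open>x = l y - A y\<close> this says that \<open>G x \<le> s b\<close> implies \<open>G (l I - A)\<^sup>-\<^sup>1 x \<le> (s / l) b\<close>.  Only real
  eigenvalues of \<open>A\<close> are excluded; the invariance is transported down the real axis.
\<close>

lemma polyhedron_of_resolvent: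
  fixes A :: "real^'n^'n" and G :: "real^'n^'m"
  assumes E: "0 \<le> E" "E ** G = G ** (A + \<gamma> *\<^sub>R mat 1)" "E *v b \<le> \<gamma> *\<^sub>R b"
    and "0 < \<gamma>" "0 < \<nu>"
    and no_eig: "\<And>l v. \<nu> \<le> l \<Longrightarrow> A *v v = l *\<^sub>R v \<Longrightarrow> v = 0"
    and "\<nu> \<le> l" "0 \<le> s" "l *\<^sub>R y - A *v y \<in> polyhedron_of G (s *\<^sub>R b)"
  shows "y \<in> polyhedron_of G ((s / l) *\<^sub>R b)"
proof -
  let ?B = "A + \<gamma> *\<^sub>R mat 1"
  define good where "good l \<longleftrightarrow> (\<forall>s y. 0 \<le> s \<longrightarrow> l *\<^sub>R y - A *v y \<in> polyhedron_of G (s *\<^sub>R b)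
    \<longrightarrow> y \<in> polyhedron_of G ((s / l) *\<^sub>R b))" for l
  obtain K where K: "K > 0" "\<And>v. norm (?B *v v) \<le> K * norm v"
    using matrix_norm_bound by blast
  \<comment> \<open>For large \<open>l\<close>, \<open>y\<close> is the fixed point of \<open>z \<mapsto> (x + B z) / (l + \<gamma>)\<close> with \<open>B = A + \<gamma> I\<close>.\<close>
  have large: "good l" if "l \<ge> max \<nu> K" for l
    unfolding good_def
  proof (intro allI impI)
    fix s y assume s: "0 \<le> s" "l *\<^sub>R y - A *v y \<in> polyhedron_of G (s *\<^sub>R b)"
    define \<mu> where "\<mu> = l + \<gamma>"
    have \<mu>: "\<mu> > 0" "\<mu> > K" "\<mu> > \<gamma>" "l = \<mu> - \<gamma>"
      using that \<open>0 < \<gamma>\<close> \<open>0 < \<nu>\<close> by (auto simp: \<mu>_def)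
    have "y \<in> polyhedron_of G (((1 / \<mu>) * s / (1 - \<gamma> / \<mu>)) *\<^sub>R b)"
    proof (rule polyhedron_of_fixpoint[where T = "(1 / \<mu>) *\<^sub>R ?B" and q = "K / \<mu>"])
      show "norm (((1 / \<mu>) *\<^sub>R ?B) *v v) \<le> K / \<mu> * norm v" for v
        using divide_right_mono[OF K(2)[of v], of \<mu>] \<mu>(1)
        unfolding scaleR_matrix_vector_assoc[symmetric] by simp
      show "((1 / \<mu>) *\<^sub>R ?B) *v v \<in> polyhedron_of G ((\<gamma> / \<mu> * s) *\<^sub>R b)"
        if "0 \<le> s" "v \<in> polyhedron_of G (s *\<^sub>R b)" for s v
        using polyhedron_of_scaleR[OF _ polyhedron_of_shift_step[OF E that], of "1 / \<mu>"] \<mu>(1)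
        by (simp add: scaleR_matrix_vector_assoc[symmetric])
      show "(1 / \<mu>) *\<^sub>R (l *\<^sub>R y - A *v y) \<in> polyhedron_of G (((1 / \<mu>) * s) *\<^sub>R b)"
        using polyhedron_of_scaleR[OF _ s(2), of "1 / \<mu>"] \<mu>(1) by simp
      have "(1 / \<mu>) *\<^sub>R (l *\<^sub>R y - A *v y) + ((1 / \<mu>) *\<^sub>R ?B) *v y = (1 / \<mu>) *\<^sub>R (\<mu> *\<^sub>R y)"
        by (simp add: scaleR_matrix_vector_assoc[symmetric] matrix_vector_mult_add_rdistrib
            scaleR_add_right[symmetric] \<mu>_def scaleR_add_left)
      then show "y = (1 / \<mu>) *\<^sub>R (l *\<^sub>R y - A *v y) + ((1 / \<mu>) *\<^sub>R ?B) *v y"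
        using \<mu>(1) by simp
    qed (use \<mu> K s \<open>0 < \<gamma>\<close> in auto)
    also have "(1 / \<mu>) * s / (1 - \<gamma> / \<mu>) = s / l"
      using \<mu> by (simp add: field_simps)
    finally show "y \<in> polyhedron_of G ((s / l) *\<^sub>R b)" .
  qed
  obtain e where e: "e > 0"
    "\<And>l v. l \<in> {\<nu>..max \<nu> K} \<Longrightarrow> e * norm v \<le> norm (l *\<^sub>R v - A *v v)"
    using uniform_lower_bound[of \<nu> "max \<nu> K" A] no_eig by (meson atLeastAtMost_iff max.cobounded1)
  \<comment> \<open>The resolvent at \<open>l'\<close> is obtained from the one at \<open>l\<close> as the fixed point of
    \<open>z \<mapsto> (l I - A)\<^sup>-\<^sup>1 (x + (l - l') z)\<close>.  As \<open>norm ((l I - A)\<^sup>-\<^sup>1) \<le> 1 / e\<close> uniformly, the step length \<open>e / 2\<close>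
    gives the contraction factor \<open>1 / 2\<close>.\<close>
  have step: "good l'" if l: "good l" "l \<in> {\<nu>..max \<nu> K}" "l - e / 2 \<le> l'" "\<nu> \<le> l'" "l' \<le> l" for l l'
    unfolding good_def
  proof (intro allI impI)
    fix s y assume s: "0 \<le> s" "l' *\<^sub>R y - A *v y \<in> polyhedron_of G (s *\<^sub>R b)"
    define M where "M = l *\<^sub>R mat 1 - A"
    have M_mult: "M *v v = l *\<^sub>R v - A *v v" for v
      by (simp add: M_def matrix_vector_mult_diff_rdistrib scaleR_matrix_vector_assoc[symmetric])
    have "invertible M"
    proof (rule invertible_if_ker_trivial)
      fix v assume "M *v v = 0"
      then show "v = 0" using no_eig[of l v] l by (simp add: M_mult)
    qed
    note R = matrix_inv_left_right[OF this]
    let ?R = "matrix_inv M"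
    have MR: "M *v (?R *v v) = v" and RM: "?R *v (M *v v) = v" for v
      by (simp_all add: matrix_vector_mul_assoc R)
    have R_norm: "e * norm (?R *v v) \<le> norm v" for v
      using e(2)[OF l(2), of "?R *v v"] by (simp add: M_mult[symmetric] MR)
    have R_in: "?R *v v \<in> polyhedron_of G ((s / l) *\<^sub>R b)"
      if "0 \<le> s" "v \<in> polyhedron_of G (s *\<^sub>R b)" for s v
      using l(1) that MR[of v] by (auto simp: good_def M_mult)
    have "l > 0" using l \<open>0 < \<nu>\<close> by simp
    have "y \<in> polyhedron_of G ((s / l / (1 - (l - l') / l)) *\<^sub>R b)"
    proof (rule polyhedron_of_fixpoint[where T = "(l - l') *\<^sub>R ?R" and q = "1 / 2"])
      show "norm (((l - l') *\<^sub>R ?R) *v v) \<le> 1 / 2 * norm v" for v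
      proof -
        have "norm (((l - l') *\<^sub>R ?R) *v v) = (l - l') * norm (?R *v v)"
          using l by (simp add: scaleR_matrix_vector_assoc[symmetric])
        also have "\<dots> \<le> (e / 2) * norm (?R *v v)"
          using l by (intro mult_right_mono) auto
        also have "\<dots> \<le> 1 / 2 * norm v" using R_norm[of v] by simp
        finally show ?thesis .
      qed
      show "((l - l') *\<^sub>R ?R) *v v \<in> polyhedron_of G (((l - l') / l * s) *\<^sub>R b)"
        if "0 \<le> s" "v \<in> polyhedron_of G (s *\<^sub>R b)" for s v
        using polyhedron_of_scaleR[OF _ R_in[OF that], of "l - l'"] l
        by (simp add: scaleR_matrix_vector_assoc[symmetric])
      show "?R *v (l' *\<^sub>R y - A *v y) \<in> polyhedron_of G ((s / l) *\<^sub>R b)"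
        by (intro R_in s)
      have "?R *v (l' *\<^sub>R y - A *v y) + ((l - l') *\<^sub>R ?R) *v y = ?R *v (M *v y)"
        by (simp add: scaleR_matrix_vector_assoc[symmetric] M_mult algebra_simps)
      then show "y = ?R *v (l' *\<^sub>R y - A *v y) + ((l - l') *\<^sub>R ?R) *v y"
        by (simp add: RM)
    qed (use l \<open>l > 0\<close> \<open>0 < \<nu>\<close> s in auto)
    also have "s / l / (1 - (l - l') / l) = s / l'"
      using \<open>l > 0\<close> l(4) \<open>0 < \<nu>\<close> by (simp add: field_simps)
    finally show "y \<in> polyhedron_of G ((s / l') *\<^sub>R b)" .
  qed
  \<comment> \<open>Induction on the number \<open>n\<close> of steps of length \<open>e / 2\<close> down from the range of \<open>large\<close>.\<close>
  have down: "good l" if "\<nu> \<le> l" "max \<nu> K - real n * (e / 2) \<le> l" for n l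
    using that
  proof (induction n arbitrary: l)
    case 0
    then show ?case by (intro large) simp
  next
    case (Suc n)
    show ?case
    proof (cases "max \<nu> K \<le> l")
      case False
      let ?l = "min (max \<nu> K) (l + e / 2)"
      show ?thesis
      proof (rule step)
        show "good ?l"
          using Suc.prems e(1) False by (intro Suc.IH) (auto simp: algebra_simps min_def add_divide_distrib)
      qed (use Suc.prems e(1) False in auto)
    qed (rule large)
  qed
  obtain n where "(max \<nu> K - l) / (e / 2) \<le> real n"
    using real_arch_simple by blast
  then have "max \<nu> K - real n * (e / 2) \<le> l"
    using e(1) by (simp add: field_simps)
  from down[OF \<open>\<nu> \<le> l\<close> this] show ?thesis
    using assms unfolding good_def by blast
qed

text \<open>
  With \<open>R = (\<nu> I - A)\<^sup>-\<^sup>1\<close> and \<open>\<mu> = \<nu> + \<gamma>\<close>, the vectors \<open>z\<^sub>k = (\<gamma>\<^sup>k / \<nu>) b - G R B\<^sup>k x\<close> are nonnegative and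
  satisfy \<open>\<mu> z\<^sub>k - z\<^sub>k\<^sub>+\<^sub>1 = \<gamma>\<^sup>k b - G B\<^sup>k x \<ge> 0\<close>.  Hence \<open>z\<^sub>k \<le> \<mu>\<^sup>k z\<^sub>0\<close>, and the gap is at most \<open>\<mu>\<^sup>k\<^sup>+\<^sup>1 z\<^sub>0\<close>.
\<close>

lemma polyhedron_orbit_growth:
  fixes A :: "real^'n^'n" and G :: "real^'n^'m"
  assumes E: "0 \<le> E" "E ** G = G ** (A + \<gamma> *\<^sub>R mat 1)" "E *v b \<le> \<gamma> *\<^sub>R b"
    and "0 < \<gamma>" "0 < \<nu>"
    and no_eig: "\<And>l v. \<nu> \<le> l \<Longrightarrow> A *v v = l *\<^sub>R v \<Longrightarrow> v = 0"
    and x: "x \<in> polyhedron_of G b"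
  shows "\<exists>C. \<forall>k. norm (G *v (matrix_power (A + \<gamma> *\<^sub>R mat 1) k *v x)) \<le> C * (\<nu> + \<gamma>) ^ k"
proof -
  let ?B = "A + \<gamma> *\<^sub>R mat 1"
  define M where "M = \<nu> *\<^sub>R mat 1 - A"
  have M_mult: "M *v v = \<nu> *\<^sub>R v - A *v v" for v
    by (simp add: M_def matrix_vector_mult_diff_rdistrib scaleR_matrix_vector_assoc[symmetric])
  have "invertible M"
  proof (rule invertible_if_ker_trivial)
    fix v assume "M *v v = 0"
    then show "v = 0" using no_eig[of \<nu> v] by (simp add: M_mult)
  qed
  note R = matrix_inv_left_right[OF this]
  let ?R = "matrix_inv M"
  have MR: "M *v (?R *v v) = v" and RM: "?R *v (M *v v) = v" for v
    by (simp_all add: matrix_vector_mul_assoc R)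
  define \<mu> where "\<mu> = \<nu> + \<gamma>"
  have \<mu>: "\<mu> > 0" "\<gamma> < \<mu>" using \<open>0 < \<gamma>\<close> \<open>0 < \<nu>\<close> by (auto simp: \<mu>_def)
  define X where "X k = matrix_power ?B k *v x" for k
  have X_Suc: "X (Suc k) = ?B *v X k" for k
    by (simp add: X_def matrix_vector_mul_assoc)
  have X_in: "X k \<in> polyhedron_of G (\<gamma> ^ k *\<^sub>R b)" for k
    unfolding X_def using E x \<open>0 < \<gamma>\<close> by (intro polyhedron_of_shift_power) auto
  define z where "z k = (\<gamma> ^ k / \<nu>) *\<^sub>R b - G *v (?R *v X k)" for k
  have z_nonneg: "0 \<le> z k" for k
  proof -
    have "?R *v X k \<in> polyhedron_of G ((\<gamma> ^ k / \<nu>) *\<^sub>R b)"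
      using X_in[of k] E \<open>0 < \<gamma>\<close> \<open>0 < \<nu>\<close> no_eig
      by (intro polyhedron_of_resolvent[of E G A \<gamma> b \<nu>]) (auto simp: M_mult[symmetric] MR)
    then show ?thesis by (simp add: polyhedron_of_def z_def)
  qed
  have gap: "\<gamma> ^ k *\<^sub>R b - G *v X k = \<mu> *\<^sub>R z k - z (Suc k)" for k
  proof -
    have "X k = \<mu> *\<^sub>R (?R *v X k) - ?R *v X (Suc k)"
    proof -
      have "?R *v X (Suc k) = ?R *v (\<mu> *\<^sub>R X k - M *v X k)"
        by (simp add: X_Suc M_mult \<mu>_def matrix_vector_mult_add_rdistrib
            scaleR_matrix_vector_assoc[symmetric] scaleR_add_left add.commute)
      also have "\<dots> = \<mu> *\<^sub>R (?R *v X k) - X k"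
        by (simp add: matrix_vector_mult_diff_distrib matrix_vector_mult_scaleR RM)
      finally show ?thesis by simp
    qed
    then have "G *v X k = \<mu> *\<^sub>R (G *v (?R *v X k)) - G *v (?R *v X (Suc k))"
      by (metis matrix_vector_mult_diff_distrib matrix_vector_mult_scaleR)
    moreover have "\<gamma> ^ k = \<mu> * (\<gamma> ^ k / \<nu>) - \<gamma> ^ Suc k / \<nu>"
      using \<open>0 < \<nu>\<close> by (simp add: \<mu>_def field_simps)
    then have "\<gamma> ^ k *\<^sub>R b = \<mu> *\<^sub>R ((\<gamma> ^ k / \<nu>) *\<^sub>R b) - (\<gamma> ^ Suc k / \<nu>) *\<^sub>R b"
      by (metis scaleR_diff_left scaleR_scaleR)
    ultimately show ?thesis
      by (simp add: z_def scaleR_diff_right)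
  qed
  have gap_nonneg: "0 \<le> \<gamma> ^ k *\<^sub>R b - G *v X k" for k
    using X_in[of k] by (simp add: polyhedron_of_def)
  have z_le: "z k $ j \<le> \<mu> ^ k * z 0 $ j" for k j
  proof (induction k)
    case (Suc k)
    have "0 \<le> (\<mu> *\<^sub>R z k - z (Suc k)) $ j"
      using gap_nonneg[of k] unfolding gap by (simp add: less_eq_vec_def)
    then have "z (Suc k) $ j \<le> \<mu> * z k $ j" by simp
    also have "\<dots> \<le> \<mu> * (\<mu> ^ k * z 0 $ j)"
      using Suc \<mu> by (intro mult_left_mono) auto
    finally show ?case by simp
  qed simp
  have comp: "\<bar>(G *v X k) $ j\<bar> \<le> (\<bar>b $ j\<bar> + \<mu> * z 0 $ j) * \<mu> ^ k" for k j
  proof -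
    let ?v = "(\<gamma> ^ k *\<^sub>R b - G *v X k) $ j"
    have "0 \<le> ?v" using gap_nonneg[of k] by (simp add: less_eq_vec_def)
    moreover have "?v \<le> \<mu> * z k $ j"
      unfolding gap using z_nonneg[of "Suc k"] by (simp add: less_eq_vec_def)
    moreover have "\<mu> * z k $ j \<le> \<mu> * (\<mu> ^ k * z 0 $ j)"
      using z_le[of k j] \<mu> by (intro mult_left_mono) auto
    moreover have "\<bar>\<gamma> ^ k * b $ j\<bar> \<le> \<bar>b $ j\<bar> * \<mu> ^ k"
      using \<mu> \<open>0 < \<gamma>\<close> by (simp add: abs_mult mult.commute mult_right_mono power_mono)
    ultimately show ?thesis by (simp add: algebra_simps abs_le_iff)
  qed
  have "norm (G *v X k) \<le> (\<Sum>j\<in>UNIV. \<bar>b $ j\<bar> + \<mu> * z 0 $ j) * \<mu> ^ k" for k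
  proof -
    have "norm (G *v X k) \<le> (\<Sum>j\<in>UNIV. \<bar>(G *v X k) $ j\<bar>)"
      by (rule norm_le_l1_cart)
    also have "\<dots> \<le> (\<Sum>j\<in>UNIV. (\<bar>b $ j\<bar> + \<mu> * z 0 $ j) * \<mu> ^ k)"
      by (intro sum_mono comp)
    finally show ?thesis by (simp add: sum_distrib_right)
  qed
  then show ?thesis unfolding X_def \<mu>_def by blast
qed

section \<open>Eigenvalues and zeros of the denominator\<close>

lemma poly_0_nonzero_if_invertible:
  fixes A :: "real^'n^'n"
  assumes "invertible (matrix_poly h (0 *\<^sub>R A))"
  shows "poly h 0 \<noteq> 0"
proof
  assume "poly h 0 = 0"
  then have "matrix_poly h (0 *\<^sub>R A) *v v = 0" for v
    using matrix_poly_eigenvector[of "0 *\<^sub>R A" v 0 h] by simp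
  then have "v = 0" for v :: "real^'n"
    using invertible_mult_eq_0[OF assms] by blast
  then show False
    by (metis zero_neq_one)
qed

text \<open>
  The eigenvalues of \<open>d A\<close> on the positive real axis lie below the first positive zero \<open>p\<close> of \<open>h\<close>, and
  \<open>d \<nu>\<close> is chosen strictly between.  Without such a zero any large \<open>\<nu>\<close> will do.
\<close>

lemma exists_eigenvalue_bound:
  fixes A :: "real^'n^'n"
  assumes "0 \<le> d"
    and inv: "\<And>d'. 0 \<le> d' \<Longrightarrow> d' \<le> d \<Longrightarrow> invertible (matrix_poly h (d' *\<^sub>R A))"
  obtains \<nu> where "\<nu> > 0" "\<And>l v. \<nu> \<le> l \<Longrightarrow> A *v v = l *\<^sub>R v \<Longrightarrow> v = 0"
    "\<And>t. 0 \<le> t \<Longrightarrow> t \<le> d * \<nu> \<Longrightarrow> poly h t \<noteq> 0"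
proof -
  have h0: "poly h 0 \<noteq> 0"
    using inv[of 0] \<open>0 \<le> d\<close> poly_0_nonzero_if_invertible by simp
  obtain K where K: "K > 0" "\<And>v. norm (A *v v) \<le> K * norm v"
    using matrix_norm_bound by blast
  have big: "v = 0" if "K + 1 \<le> l" "A *v v = l *\<^sub>R v" for l v
  proof -
    have "l * norm v \<le> K * norm v"
      using K(2)[of v] that K(1) by simp
    then have "(l - K) * norm v \<le> 0" by (simp add: algebra_simps)
    then show "v = 0" using that(1) by (simp add: mult_le_0_iff)
  qed
  define Z where "Z = {t\<in>{0..d * (K + 1)}. poly h t = 0}"
  show thesis
  proof (cases "Z = {}")
    case True
    then show thesis
      using big K(1) by (intro that[of "K + 1"]) (auto simp: Z_def)
  next
    case False
    have "finite Z"
      unfolding Z_def using h0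
      by (intro finite_subset[OF _ poly_roots_finite[of h]]) auto
    define p where "p = Min Z"
    have "p \<in> Z" and p_least: "\<And>t. t \<in> Z \<Longrightarrow> p \<le> t"
      using Min_in[OF \<open>finite Z\<close> False] Min_le[OF \<open>finite Z\<close>] by (auto simp: p_def)
    then have p: "0 < p" "p \<le> d * (K + 1)" "poly h p = 0"
      using h0 by (auto simp: Z_def less_le)
    then have "d > 0" using \<open>0 \<le> d\<close> by (cases "d = 0") auto
    have no_eig: "v = 0" if "p / d \<le> l" "A *v v = l *\<^sub>R v" for l v
    proof -
      have "0 < p / d" using p \<open>d > 0\<close> by simp
      then have "l > 0" using that by linarith
      then have "p / l \<le> d" using that \<open>d > 0\<close> by (simp add: field_simps)
      have "((p / l) *\<^sub>R A) *v v = p *\<^sub>R v"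
        using that(2) \<open>l > 0\<close> by (simp add: scaleR_matrix_vector_assoc[symmetric])
      from matrix_poly_eigenvector[OF this, of h] show "v = 0"
        using p \<open>l > 0\<close> \<open>p / l \<le> d\<close> invertible_mult_eq_0[OF inv[of "p / l"], of v] by simp
    qed
    \<comment> \<open>Since \<open>p / d\<close> is no eigenvalue, neither is any number at distance less than \<open>e\<close>.\<close>
    obtain e where e: "e > 0" "\<And>v. e * norm v \<le> norm ((p / d) *\<^sub>R v - A *v v)"
      using uniform_lower_bound[of "p / d" "p / d" A] no_eig
      by (meson atLeastAtMost_iff order_refl)
    define \<nu> where "\<nu> = max (p / d / 2) (p / d - e / 2)"
    have \<nu>: "0 < \<nu>" "\<nu> < p / d" "p / d - e < \<nu>"
    proof -
      have "0 < max (a / 2) (a - e / 2) \<and> max (a / 2) (a - e / 2) < a \<and> a - e < max (a / 2) (a - e / 2)"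
        if "0 < a" for a
        using that e(1) by (auto simp: less_max_iff_disj)
      from this[of "p / d"] show "0 < \<nu>" "\<nu> < p / d" "p / d - e < \<nu>"
        using p \<open>d > 0\<close> by (simp_all add: \<nu>_def)
    qed
    show thesis
    proof (rule that[of \<nu>])
      show "v = 0" if "\<nu> \<le> l" "A *v v = l *\<^sub>R v" for l v
      proof (cases "p / d \<le> l")
        case False
        have "e * norm v \<le> (p / d - l) * norm v"
          using e(2)[of v] that False by (simp add: scaleR_diff_left[symmetric])
        then have "(e - (p / d - l)) * norm v \<le> 0" by (simp add: algebra_simps)
        then show "v = 0" using \<nu>(3) that(1) by (simp add: mult_le_0_iff)
      qed (use no_eig that in auto)
      show "poly h t \<noteq> 0" if "0 \<le> t" "t \<le> d * \<nu>" for t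
      proof
        assume "poly h t = 0"
        have "d * \<nu> < p" using \<nu>(2) \<open>d > 0\<close> by (simp add: field_simps)
        then have "t \<in> Z" using that \<open>poly h t = 0\<close> p by (auto simp: Z_def)
        then show False using p_least[of t] that \<open>d * \<nu> < p\<close> by linarith
      qed
    qed (rule \<nu>)
  qed
qed

section \<open>Power series along an orbit\<close>

lemma coeff_eq_sum_fps_mult:
  fixes p q :: "real poly" and F :: "real fps"
  assumes "fps_of_poly p * F = fps_of_poly q"
  shows "coeff q k = (\<Sum>l\<le>degree p. if k < l then 0 else coeff p l * fps_nth F (k - l))"
proof -
  have "coeff q k = (\<Sum>l\<in>{0..k}. coeff p l * fps_nth F (k - l))"
    unfolding fps_of_poly_nth[of q k, symmetric] assms[symmetric] by (simp add: fps_mult_nth)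
  also have "\<dots> = (\<Sum>l\<in>{0..k} \<inter> {..degree p}. coeff p l * fps_nth F (k - l))"
    by (rule sum.mono_neutral_right) (auto intro: coeff_eq_0)
  also have "\<dots> = (\<Sum>l\<le>degree p. if k < l then 0 else coeff p l * fps_nth F (k - l))"
    by (rule sum.mono_neutral_cong_left) auto
  finally show ?thesis .
qed

text \<open>
  Multiplication of \<open>\<Sum>k. F\<^sub>k w\<^sub>k\<close> by the polynomial \<open>p\<close> in the shift operator \<open>w\<^sub>k \<mapsto> w\<^sub>k\<^sub>+\<^sub>1\<close> turns the
  formal identity \<open>p F = q\<close> into an identity of vectors.
\<close>

lemma sum_coeff_suminf_shift:
  fixes p q :: "real poly" and F :: "real fps" and w :: "nat \<Rightarrow> 'a :: banach"
  assumes F: "fps_of_poly p * F = fps_of_poly q"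
    and summ: "\<And>l. summable (\<lambda>k. fps_nth F k *\<^sub>R w (k + l))"
  shows "(\<Sum>l\<le>degree p. coeff p l *\<^sub>R (\<Sum>k. fps_nth F k *\<^sub>R w (k + l)))
       = (\<Sum>k\<le>degree q. coeff q k *\<^sub>R w k)"
proof -
  have "(\<lambda>k. if k < l then 0 else fps_nth F (k - l) *\<^sub>R w k) sums (\<Sum>k. fps_nth F k *\<^sub>R w (k + l))"
    for l
  proof -
    have "(\<lambda>k. if k + l < l then 0 else fps_nth F (k + l - l) *\<^sub>R w (k + l))
        sums (\<Sum>k. fps_nth F k *\<^sub>R w (k + l))"
      using summ[of l] by (simp add: summable_sums)
    then show ?thesis
      by (subst (asm) sums_zero_iff_shift) auto
  qed
  then have "(\<lambda>k. \<Sum>l\<le>degree p. coeff p l *\<^sub>R (if k < l then 0 else fps_nth F (k - l) *\<^sub>R w k))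
      sums (\<Sum>l\<le>degree p. coeff p l *\<^sub>R (\<Sum>k. fps_nth F k *\<^sub>R w (k + l)))"
    by (intro sums_sum sums_scaleR_right)
  moreover have "(\<Sum>l\<le>degree p. coeff p l *\<^sub>R (if k < l then 0 else fps_nth F (k - l) *\<^sub>R w k))
      = coeff q k *\<^sub>R w k" for k
    unfolding coeff_eq_sum_fps_mult[OF F] scaleR_left.sum by (intro sum.cong) auto
  ultimately have "(\<lambda>k. coeff q k *\<^sub>R w k)
      sums (\<Sum>l\<le>degree p. coeff p l *\<^sub>R (\<Sum>k. fps_nth F k *\<^sub>R w (k + l)))"
    by simp
  moreover have "(\<lambda>k. coeff q k *\<^sub>R w k) sums (\<Sum>k\<le>degree q. coeff q k *\<^sub>R w k)"
    by (rule sums_finite) (auto simp: coeff_eq_0)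
  ultimately show ?thesis
    by (rule sums_unique2)
qed

lemma summable_fps_times_geometric:
  fixes F :: "real fps" and w :: "nat \<Rightarrow> 'a :: banach"
  assumes "\<And>k. 0 \<le> fps_nth F k" "summable (\<lambda>k. fps_nth F k * R ^ k)"
    and w: "\<And>k. norm (w k) \<le> C * R ^ k"
  shows "summable (\<lambda>k. fps_nth F k *\<^sub>R w (k + l))"
proof (rule summable_comparison_test')
  show "summable (\<lambda>k. (C * R ^ l) * (fps_nth F k * R ^ k))"
    using assms(2) by (rule summable_mult)
  show "norm (fps_nth F k *\<^sub>R w (k + l)) \<le> (C * R ^ l) * (fps_nth F k * R ^ k)" for k
    using mult_left_mono[OF w[of "k + l"] assms(1)[of k]] assms(1)[of k]
    by (simp add: power_add mult_ac)
qed

section \<open>Invariance under the rational discretization\<close>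

lemma matrix_ratfun_preserves_polyhedron:
  fixes A :: "real^'n^'n" and G :: "real^'n^'m"
  assumes E: "0 \<le> E" "E ** G = G ** (A + \<gamma> *\<^sub>R mat 1)" "E *v b \<le> \<gamma> *\<^sub>R b"
    and "0 < \<gamma>" "0 \<le> d"
    and r: "is_ratfun r g h" "r 0 = 1" "absolutely_monotonic_on r {-(d * \<gamma>)..0}"
    and inv: "\<And>d'. 0 \<le> d' \<Longrightarrow> d' \<le> d \<Longrightarrow> invertible (matrix_poly h (d' *\<^sub>R A))"
    and x: "x \<in> polyhedron_of G b"
  shows "matrix_ratfun g h (d *\<^sub>R A) *v x \<in> polyhedron_of G b"
proof -
  define \<kappa> where "\<kappa> = d * \<gamma>"
  have "0 \<le> \<kappa>" using \<open>0 < \<gamma>\<close> \<open>0 \<le> d\<close> by (simp add: \<kappa>_def)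
  obtain \<nu> where \<nu>: "\<nu> > 0" "\<And>l v. \<nu> \<le> l \<Longrightarrow> A *v v = l *\<^sub>R v \<Longrightarrow> v = 0"
    "\<And>t. 0 \<le> t \<Longrightarrow> t \<le> d * \<nu> \<Longrightarrow> poly h t \<noteq> 0"
    using exists_eigenvalue_bound[OF \<open>0 \<le> d\<close> inv] by blast
  define R where "R = \<kappa> + d * \<nu>"
  have R: "\<kappa> \<le> R" "R = d * (\<nu> + \<gamma>)"
    using \<nu>(1) \<open>0 \<le> d\<close> by (auto simp: R_def \<kappa>_def algebra_simps)
  define p where "p = pcompose h [:-\<kappa>, 1:]"
  define q where "q = pcompose g [:-\<kappa>, 1:]"
  obtain F :: "real fps" where F: "fps_of_poly p * F = fps_of_poly q"
    "\<And>k. 0 \<le> fps_nth F k" "summable (\<lambda>k. fps_nth F k * R ^ k)"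
  proof -
    have "0 \<le> d * \<gamma>" "0 \<le> d * \<nu>"
      using \<open>0 < \<gamma>\<close> \<nu>(1) \<open>0 \<le> d\<close> by auto
    from absolutely_monotonic_ratfun_fps[OF r(1,3) this \<nu>(3)] show thesis
      using that unfolding R_def \<kappa>_def p_def q_def by blast
  qed

  define M where "M = d *\<^sub>R (A + \<gamma> *\<^sub>R mat 1)"
  define N where "N = d *\<^sub>R E"
  have NG: "N ** G = G ** M"
    by (simp add: N_def M_def matrix_scalar_ac scalar_matrix_assoc[symmetric] E(2))
  have "0 \<le> N"
    using E(1) \<open>0 \<le> d\<close> by (simp add: N_def less_eq_vec_def)
  have Nb: "N *v b \<le> \<kappa> *\<^sub>R b"
    using E(3) \<open>0 \<le> d\<close>
    by (simp add: N_def scaleR_matrix_vector_assoc[symmetric] \<kappa>_def less_eq_vec_def mult_left_mono mult.assoc)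
  have "(-\<kappa>) *\<^sub>R mat 1 + M = d *\<^sub>R A"
    by (simp add: M_def \<kappa>_def scaleR_add_right)
  then have poly_M: "matrix_poly p M = matrix_poly h (d *\<^sub>R A)" "matrix_poly q M = matrix_poly g (d *\<^sub>R A)"
    by (simp_all only: p_def q_def matrix_poly_pcompose_shift)

  define w where "w k = G *v (matrix_power M k *v x)" for k
  have w_shift: "w (k + l) = matrix_power N l *v w k" for k l
  proof (induction l)
    case (Suc l)
    have "w (k + Suc l) = N *v w (k + l)"
      by (simp add: w_def matrix_vector_mul_assoc matrix_mul_assoc NG)
    then show ?case by (simp add: Suc.IH matrix_vector_mul_assoc)
  qed simp
  have w_le: "w k \<le> \<kappa> ^ k *\<^sub>R b" for k
    using polyhedron_of_shift_power[OF \<open>0 \<le> N\<close> NG Nb \<open>0 \<le> \<kappa>\<close> x, of k]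
    by (simp add: polyhedron_of_def w_def)
  obtain C where C: "\<And>k. norm (G *v (matrix_power (A + \<gamma> *\<^sub>R mat 1) k *v x)) \<le> C * (\<nu> + \<gamma>) ^ k"
    using polyhedron_orbit_growth[OF E \<open>0 < \<gamma>\<close> \<nu>(1) _ x] \<nu>(2) by blast
  have w_norm: "norm (w k) \<le> C * R ^ k" for k
    using mult_left_mono[OF C[of k], of "d ^ k"] \<open>0 \<le> d\<close>
    by (simp add: w_def M_def matrix_power_scaleR scaleR_matrix_vector_assoc[symmetric]
        matrix_vector_mult_scaleR R(2) power_mult_distrib mult_ac)
  note w_summable = summable_fps_times_geometric[OF F(2,3) w_norm]

  \<comment> \<open>\<open>W\<close> is the candidate for \<open>G r(d A) x\<close>.\<close>
  define W where "W = (\<Sum>k. fps_nth F k *\<^sub>R w k)"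
  have W_sums: "(\<lambda>k. fps_nth F k *\<^sub>R w k) sums W"
    using w_summable[of 0] by (simp add: W_def summable_sums)
  have "(\<Sum>k. fps_nth F k *\<^sub>R w (k + l)) = matrix_power N l *v W" for l
  proof -
    have "(\<lambda>k. matrix_power N l *v (fps_nth F k *\<^sub>R w k)) sums (matrix_power N l *v W)"
      by (rule bounded_linear.sums[OF matrix_vector_mul_bounded_linear W_sums])
    then show ?thesis
      by (simp add: matrix_vector_mult_scaleR w_shift sums_iff)
  qed
  with sum_coeff_suminf_shift[OF F(1) w_summable]
  have "matrix_poly p N *v W = (\<Sum>k\<le>degree q. coeff q k *\<^sub>R w k)"
    by (simp add: matrix_poly_mult_vector)
  also have "\<dots> = G *v (matrix_poly q M *v x)"
    by (simp add: matrix_poly_mult_vector w_def matrix_vector_mult_sum_right matrix_vector_mult_scaleR)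
  finally have pW: "matrix_poly p N *v W = G *v (matrix_poly q M *v x)" .

  have "W \<in> range ((*v) G)"
  proof (rule Lim_in_closed_set)
    show "closed (range ((*v) G))"
      by (intro closed_subspace linear_subspace_image) auto
    show "(\<lambda>n. \<Sum>k<n. fps_nth F k *\<^sub>R w k) \<longlonglongrightarrow> W"
      using W_sums by (simp add: sums_def)
    have "(\<Sum>k<n. fps_nth F k *\<^sub>R w k)
        = G *v (\<Sum>k<n. fps_nth F k *\<^sub>R (matrix_power M k *v x))" for n
      by (simp add: matrix_vector_mult_sum_right matrix_vector_mult_scaleR w_def)
    then show "\<forall>\<^sub>F n in sequentially. (\<Sum>k<n. fps_nth F k *\<^sub>R w k) \<in> range ((*v) G)"
      by simp
  qed auto
  then obtain u where u: "W = G *v u" by blast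
  define y where "y = matrix_ratfun g h (d *\<^sub>R A) *v x"
  have h_inv: "invertible (matrix_poly p M)"
    unfolding poly_M using inv[of d] \<open>0 \<le> d\<close> by simp
  have hy: "matrix_poly p M *v y = matrix_poly q M *v x"
    using matrix_inv_left_right(1)[OF h_inv]
    by (simp add: y_def matrix_ratfun_def poly_M matrix_vector_mul_assoc matrix_mul_assoc)
  note pG = matrix_poly_intertwine[OF NG, of p]
  \<comment> \<open>\<open>h(d A)\<close> maps both \<open>u\<close> and \<open>y\<close> to \<open>g(d A) x\<close> modulo the kernel of \<open>G\<close>.\<close>
  have "G *v (u - y) = 0"
  proof (rule invertible_stable_kernel[OF h_inv])
    show "G *v (matrix_poly p M *v v) = 0" if "G *v v = 0" for v
    proof -
      have "G *v (matrix_poly p M *v v) = matrix_poly p N *v (G *v v)"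
        by (simp add: matrix_vector_mul_assoc pG)
      then show ?thesis using that by simp
    qed
    have "G *v (matrix_poly p M *v u) = matrix_poly p N *v W"
      by (simp add: u matrix_vector_mul_assoc pG)
    then show "G *v (matrix_poly p M *v (u - y)) = 0"
      by (simp add: matrix_vector_mult_diff_distrib pW hy)
  qed
  then have "G *v y = W" by (simp add: u matrix_vector_mult_diff_distrib)

  have F_summable: "summable (\<lambda>k. fps_nth F k *\<^sub>R \<kappa> ^ (k + l))" for l
    using R(1) \<open>0 \<le> \<kappa>\<close>
    by (intro summable_fps_times_geometric[OF F(2,3), of _ 1]) (auto intro: power_mono)
  \<comment> \<open>The same shift identity for the scalars \<open>\<kappa>\<^sup>k\<close> shows that the series for \<open>r 0\<close> has the sum \<open>1\<close>.\<close>
  define S where "S = (\<Sum>k. fps_nth F k * \<kappa> ^ k)"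
  have S_sums: "(\<lambda>k. fps_nth F k * \<kappa> ^ k) sums S"
    using F_summable[of 0] by (simp add: S_def summable_sums)
  have "(\<Sum>k. fps_nth F k *\<^sub>R \<kappa> ^ (k + l)) = \<kappa> ^ l * S" for l
    using sums_mult[OF S_sums, of "\<kappa> ^ l"] by (simp add: sums_iff power_add mult_ac)
  with sum_coeff_suminf_shift[OF F(1) F_summable]
  have "poly p \<kappa> * S = poly q \<kappa>"
    by (simp add: poly_altdef sum_distrib_right mult.assoc)
  then have "poly h 0 * S = poly g 0"
    by (simp add: p_def q_def poly_pcompose)
  moreover have "poly h 0 \<noteq> 0" using \<nu>(1) \<nu>(3)[of 0] \<open>0 \<le> d\<close> by simp
  moreover have "poly g 0 / poly h 0 = 1"
    using r(1,2) \<open>poly h 0 \<noteq> 0\<close> by (simp add: is_ratfun_def)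
  ultimately have "S = 1" by (simp add: field_simps)

  have "W $ j \<le> b $ j" for j
  proof (rule sums_le)
    show "(\<lambda>k. (fps_nth F k *\<^sub>R w k) $ j) sums (W $ j)"
      by (rule bounded_linear.sums[OF bounded_linear_vec_nth W_sums])
    show "(\<lambda>k. fps_nth F k * \<kappa> ^ k * b $ j) sums (b $ j)"
      using sums_mult2[OF S_sums, of "b $ j"] by (simp add: \<open>S = 1\<close>)
    show "(fps_nth F k *\<^sub>R w k) $ j \<le> fps_nth F k * \<kappa> ^ k * b $ j" for k
      using w_le[of k] F(2)[of k] by (simp add: less_eq_vec_def mult.assoc mult_left_mono)
  qed
  then show ?thesis
    using \<open>G *v y = W\<close> by (simp add: polyhedron_of_def y_def less_eq_vec_def)
qed

lemma abs_monotonicity_radius_imp_absolutely_monotonic: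
  assumes "abs_monotonicity_radius r \<rho>" "0 \<le> \<kappa>" "ereal \<kappa> \<le> \<rho>"
  shows "absolutely_monotonic_on r {-\<kappa>..0}"
proof -
  consider "\<rho> = \<infinity>" "absolutely_monotonic_on r {-\<kappa>..0}"
    | \<kappa>' where "\<rho> = ereal \<kappa>'" "absolutely_monotonic_on r {-\<kappa>'..0}"
    using assms(1,2) unfolding abs_monotonicity_radius_def by blast
  then show ?thesis
  proof cases
    case 2
    with assms(3) have "{-\<kappa>..0} \<subseteq> {-\<kappa>'..0}" by auto
    with 2(2) show ?thesis unfolding absolutely_monotonic_on_def by blast
  qed
qed

theorem theorem3p12:
  fixes A :: "real^'n^'n" and G :: "real^'n^'m" and b :: "real^'m" and H :: "real^'m^'m"
    and \<gamma> :: real and g h :: "real poly" and r :: "real \<Rightarrow> real" and \<rho> \<tau> :: ereal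
  assumes "invariant_continuous A (polyhedron_of G b)"
    and "offdiag_nonneg H" and "H ** G = G ** A" and "H *v b \<le> 0"
    and "\<gamma> > 0" and "0 \<le> H + \<gamma> *\<^sub>R mat 1"
    and "is_ratfun r g h" and "r 0 = 1"
    and "abs_monotonicity_radius r \<rho>" and "\<rho> > 0"
    and "\<tau> = \<rho> / ereal \<gamma>"
    and "\<And>d. 0 \<le> d \<Longrightarrow> ereal d \<le> \<tau> \<Longrightarrow> invertible (matrix_poly h (d *\<^sub>R A))"
  shows "steplength_threshold (\<lambda>d. matrix_ratfun g h (d *\<^sub>R A)) (polyhedron_of G b) \<tau>"
  unfolding steplength_threshold_def invariant_discrete_def
proof (intro conjI allI impI)
  show "0 < \<tau>"
    using assms(5,10,11) by (cases \<rho>) auto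
  fix d and x :: "nat \<Rightarrow> real^'n" and k
  assume "0 \<le> d" "ereal d \<le> \<tau>"
    and step: "\<forall>k. x (Suc k) = matrix_ratfun g h (d *\<^sub>R A) *v x k"
    and x: "x k \<in> polyhedron_of G b"
  let ?E = "H + \<gamma> *\<^sub>R mat 1"
  have "matrix_ratfun g h (d *\<^sub>R A) *v x k \<in> polyhedron_of G b"
  proof (rule matrix_ratfun_preserves_polyhedron)
    show "?E ** G = G ** (A + \<gamma> *\<^sub>R mat 1)"
      by (simp add: matrix_add_ldistrib matrix_add_rdistrib matrix_scalar_ac
          scalar_matrix_assoc[symmetric] assms(3))
    show "?E *v b \<le> \<gamma> *\<^sub>R b"
      using add_right_mono[OF assms(4), of "\<gamma> *\<^sub>R b"]
      by (simp add: matrix_vector_mult_add_rdistrib scaleR_matrix_vector_assoc[symmetric])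
    have "ereal (d * \<gamma>) \<le> \<rho>"
      using \<open>ereal d \<le> \<tau>\<close> assms(5,11) by (cases \<rho>) (auto simp: field_simps)
    then show "absolutely_monotonic_on r {-(d * \<gamma>)..0}"
      using assms(5,9) \<open>0 \<le> d\<close> by (intro abs_monotonicity_radius_imp_absolutely_monotonic) auto
    show "invertible (matrix_poly h (d' *\<^sub>R A))" if "0 \<le> d'" "d' \<le> d" for d'
      using that \<open>ereal d \<le> \<tau>\<close> by (intro assms(12)) (auto intro: order_trans[of _ "ereal d"])
  qed (use assms x \<open>0 \<le> d\<close> in auto)
  then show "x (Suc k) \<in> polyhedron_of G b"
    by (simp add: step)
qed

end
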